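(* Let $\times_{(R,\oplus)}$ be a product on components (under an interaction signature $(R,\oplus)$) that is commutative, associative, idempotent and monotonic. Let $A$ and $B$ be components such that $B$ is conformant to $A$ under $\times_{(R,\oplus)}$. Then, for any set of events $E$, any finite subset of the set of conformance coordinators $A\downarrow^* B=\{C\mid C\neq\mathbf{0} \text{ and } C\times_{(R,\oplus)} B\sqsubseteq A\}$ all of whose elements have interface $E$ has an upper bound with respect to the containment relation $\leq$ that is itself an element of $A\downarrow^* B$.
   Context: A timed-event stream (TES) over a set of events $E$ is an infinite sequence $\sigma$ with $\sigma(i)=(O_i,t_i)$, $i\in\mathbb{N}$, where $O_i\subseteq E$ and $t_i\in\mathbb{R}_+$, such that $t_i<t_{i+1}$ for all $i$ and for every $t\in\mathbb{R}_+$ there is $i$ with $t<t_i$. Write $\mathrm{pr}_1(\sigma)(i)=O_i$, $\mathrm{pr}_2(\sigma)(i)=t_i$; $\mathrm{TES}(E)$ is the set of all TESs over $E$. A component is a pair $C=(E,L)$ with $E$ a set of events (interface) and $L\subseteq\mathrm{TES}(E)$ (behavior); $\mathbf{0}=(\emptyset,\emptyset)$. An interaction signature $(R,\oplus)$ consists of, for sets of events $E_A,E_B$, a relation $R(E_A,E_B)\subseteq\mathrm{TES}(E_A)\times\mathrm{TES}(E_B)$ and a function $\oplus:\mathrm{TES}(E_A)\times\mathrm{TES}(E_B)\to\mathrm{TES}(E_A\cup E_B)$. The product of $A=(E_A,L_A)$ and $B=(E_B,L_B)$ is $A\times_{(R,\oplus)}B=(E_A\cup E_B,\{\sigma\oplus\tau\mid\sigma\in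 L_A,\tau\in L_B,(\sigma,\tau)\in R(E_A,E_B)\})$. Refinement: $(E_B,L_B)\sqsubseteq(E_A,L_A)$ iff $E_B\subseteq E_A$ and $L_B\subseteq L_A$. The product is commutative, associative, idempotent if $A\times B=B\times A$, $(A\times B)\times C=A\times(B\times C)$, $A\times A=A$ for all components; it is monotonic if $B\sqsubseteq A$ implies $B\times C\sqsubseteq A\times C$ for all components $A,B,C$. Containment: for TESs, $\sigma\leq\tau$ iff $\mathrm{pr}_1(\sigma)(i)\subseteq\mathrm{pr}_1(\tau)(i)$ for all $i$ and $\mathrm{pr}_2(\sigma)=\mathrm{pr}_2(\tau)$; for components, $(E_A,L_A)\leq(E_B,L_B)$ iff $E_A\subseteq E_B$ and every $\sigma\in L_A$ has some $\tau\in L_B$ with $\sigma\leq\tau$. $B$ is conformant to $A$ under the product if there exists a component $C\neq\mathbf{0}$ with $C\times_{(R,\oplus)}B\sqsubseteq A$. *)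

theory Defs
  imports Complex_Main
begin

type_synonym 'e tes = "nat \<Rightarrow> 'e set \<times> real"

definition pr1 :: "'e tes \<Rightarrow> nat \<Rightarrow> 'e set" where
  "pr1 \<sigma> i = fst (\<sigma> i)"

definition pr2 :: "'e tes \<Rightarrow> nat \<Rightarrow> real" where
  "pr2 \<sigma> i = snd (\<sigma> i)"

definition TES :: "'e set \<Rightarrow> 'e tes set" where
  "TES E = {\<sigma>. (\<forall>i. pr1 \<sigma> i \<subseteq> E) \<and> (\<forall>i. 0 \<le> pr2 \<sigma> i) \<and>
                (\<forall>i. pr2 \<sigma> i < pr2 \<sigma> (Suc i)) \<and> (\<forall>t\<ge>0. \<exists>i. t < pr2 \<sigma> i)}"

type_synonym 'e component = "'e set \<times> 'e tes set"

definition interface :: "'e component \<Rightarrow> 'e set" where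
  "interface C = fst C"

definition behavior :: "'e component \<Rightarrow> 'e tes set" where
  "behavior C = snd C"

definition is_component :: "'e component \<Rightarrow> bool" where
  "is_component C \<longleftrightarrow> behavior C \<subseteq> TES (interface C)"

definition zero_component :: "'e component" where
  "zero_component = ({}, {})"

text \<open>
  Both parts of an interaction signature are families indexed by the two interfaces.
  HOL functions are total: the values of \<open>oplus E\<^sub>A E\<^sub>B\<close> outside
  \<open>TES E\<^sub>A \<times> TES E\<^sub>B\<close> are irrelevant.
\<close>

type_synonym 'e composability = "'e set \<Rightarrow> 'e set \<Rightarrow> ('e tes \<times> 'e tes) set"
type_synonym 'e composition = "'e set \<Rightarrow> 'e set \<Rightarrow> 'e tes \<Rightarrow> 'e tes \<Rightarrow> 'e tes"

definition interaction_signature :: "'e composability \<Rightarrow> 'e composition \<Rightarrow> bool" where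
  "interaction_signature R oplus \<longleftrightarrow>
     (\<forall>E\<^sub>A E\<^sub>B. R E\<^sub>A E\<^sub>B \<subseteq> TES E\<^sub>A \<times> TES E\<^sub>B) \<and>
     (\<forall>E\<^sub>A E\<^sub>B. \<forall>\<sigma>\<in>TES E\<^sub>A. \<forall>\<tau>\<in>TES E\<^sub>B. oplus E\<^sub>A E\<^sub>B \<sigma> \<tau> \<in> TES (E\<^sub>A \<union> E\<^sub>B))"

definition prod_comp ::
  "'e composability \<Rightarrow> 'e composition \<Rightarrow> 'e component \<Rightarrow> 'e component \<Rightarrow> 'e component" where
  "prod_comp R oplus A B =
     (interface A \<union> interface B,
      {oplus (interface A) (interface B) \<sigma> \<tau> | \<sigma> \<tau>.
         \<sigma> \<in> behavior A \<and> \<tau> \<in> behavior B \<and> (\<sigma>, \<tau>) \<in> R (interface A) (interface B)})"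

definition refines :: "'e component \<Rightarrow> 'e component \<Rightarrow> bool"  (infix \<open>\<sqsubseteq>\<close> 50) where
  "B \<sqsubseteq> A \<longleftrightarrow> interface B \<subseteq> interface A \<and> behavior B \<subseteq> behavior A"

definition commutative_prod :: "'e composability \<Rightarrow> 'e composition \<Rightarrow> bool" where
  "commutative_prod R oplus \<longleftrightarrow>
     (\<forall>A B. is_component A \<longrightarrow> is_component B \<longrightarrow>
        prod_comp R oplus A B = prod_comp R oplus B A)"

definition associative_prod :: "'e composability \<Rightarrow> 'e composition \<Rightarrow> bool" where
  "associative_prod R oplus \<longleftrightarrow>
     (\<forall>A B C. is_component A \<longrightarrow> is_component B \<longrightarrow> is_component C \<longrightarrow>
        prod_comp R oplus (prod_comp R oplus A B) C =
        prod_comp R oplus A (prod_comp R oplus B C))"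

definition idempotent_prod :: "'e composability \<Rightarrow> 'e composition \<Rightarrow> bool" where
  "idempotent_prod R oplus \<longleftrightarrow> (\<forall>A. is_component A \<longrightarrow> prod_comp R oplus A A = A)"

definition monotonic_prod :: "'e composability \<Rightarrow> 'e composition \<Rightarrow> bool" where
  "monotonic_prod R oplus \<longleftrightarrow>
     (\<forall>A B C. is_component A \<longrightarrow> is_component B \<longrightarrow> is_component C \<longrightarrow>
        B \<sqsubseteq> A \<longrightarrow> prod_comp R oplus B C \<sqsubseteq> prod_comp R oplus A C)"

definition tes_contained :: "'e tes \<Rightarrow> 'e tes \<Rightarrow> bool" where
  "tes_contained \<sigma> \<tau> \<longleftrightarrow> (\<forall>i. pr1 \<sigma> i \<subseteq> pr1 \<tau> i) \<and> pr2 \<sigma> = pr2 \<tau>"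

definition comp_contained :: "'e component \<Rightarrow> 'e component \<Rightarrow> bool" where
  "comp_contained A B \<longleftrightarrow> interface A \<subseteq> interface B \<and>
     (\<forall>\<sigma>\<in>behavior A. \<exists>\<tau>\<in>behavior B. tes_contained \<sigma> \<tau>)"

definition conformant ::
  "'e composability \<Rightarrow> 'e composition \<Rightarrow> 'e component \<Rightarrow> 'e component \<Rightarrow> bool" where
  "conformant R oplus B A \<longleftrightarrow>
     (\<exists>C. is_component C \<and> C \<noteq> zero_component \<and> prod_comp R oplus C B \<sqsubseteq> A)"

definition conformance_coordinators ::
  "'e composability \<Rightarrow> 'e composition \<Rightarrow> 'e component \<Rightarrow> 'e component \<Rightarrow> 'e component set" where
  "conformance_coordinators R oplus A B =
     {C. is_component C \<and> C \<noteq> zero_component \<and> prod_comp R oplus C B \<sqsubseteq> A}"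

end

theory Submission
  imports Defs
begin

text \<open>
  The product of components with a common interface \<open>E\<close> is computed pairwise on behaviors, so it
  distributes over the union of behaviors. Hence the component with interface \<open>E\<close> whose behavior is
  the union of the behaviors of a nonempty family of coordinators is again a coordinator, and it
  contains each member of the family. For the empty family, conformance provides a coordinator.
\<close>

text \<open>The interface \<open>E\<close> is a parameter, so that \<open>R\<close> and
  \<open>oplus\<close>, which are indexed by interfaces, are evaluated at the same index for the
  union as for members of \<open>S\<close> with interface \<open>E\<close>.\<close>

definition union_comp :: "'e set \<Rightarrow> 'e component set \<Rightarrow> 'e component" where
  "union_comp E S = (E, \<Union> (behavior ` S))"

lemma interface_union_comp [simp]: "interface (union_comp E S) = E"
  by (simp add: union_comp_def interface_def)

lemma behavior_union_comp [simp]: "behavior (union_comp E S) = \<Union> (behavior ` S)"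
  by (simp add: union_comp_def behavior_def)

lemma interface_prod_comp [simp]:
  "interface (prod_comp R oplus A B) = interface A \<union> interface B"
  by (simp add: prod_comp_def interface_def)

lemma behavior_prod_comp:
  "behavior (prod_comp R oplus A B) =
     {oplus (interface A) (interface B) \<sigma> \<tau> | \<sigma> \<tau>.
        \<sigma> \<in> behavior A \<and> \<tau> \<in> behavior B \<and> (\<sigma>, \<tau>) \<in> R (interface A) (interface B)}"
  by (simp add: prod_comp_def behavior_def)

lemma zero_component_iff: "C = zero_component \<longleftrightarrow> interface C = {} \<and> behavior C = {}"
  by (simp add: zero_component_def interface_def behavior_def prod_eq_iff)

lemma is_component_union_comp:
  assumes "\<And>C. C \<in> S \<Longrightarrow> is_component C" and "\<And>C. C \<in> S \<Longrightarrow> interface C = E"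
  shows "is_component (union_comp E S)"
  unfolding is_component_def interface_union_comp behavior_union_comp
proof (rule UN_least)
  fix C assume "C \<in> S"
  then show "behavior C \<subseteq> TES E"
    using assms(1)[of C] assms(2)[of C] by (simp add: is_component_def)
qed

text \<open>With \<open>E\<close> shared, every member meets \<open>B\<close> under the same
  \<open>R E (interface B)\<close> and \<open>oplus E (interface B)\<close>; the pairs drawn from
  the union are then exactly those drawn from the members.\<close>

lemma behavior_prod_union_comp:
  assumes "\<And>C. C \<in> S \<Longrightarrow> interface C = E"
  shows "behavior (prod_comp R oplus (union_comp E S) B) =
           (\<Union>C\<in>S. behavior (prod_comp R oplus C B))"
proof -
  \<comment> \<open>Replacing \<open>interface C\<close> by \<open>E\<close> under the union leaves
    a purely set-theoretic identity.\<close>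
  have "(\<Union>C\<in>S. behavior (prod_comp R oplus C B)) =
          (\<Union>C\<in>S. {oplus E (interface B) \<sigma> \<tau> | \<sigma> \<tau>.
             \<sigma> \<in> behavior C \<and> \<tau> \<in> behavior B \<and> (\<sigma>, \<tau>) \<in> R E (interface B)})"
    by (rule SUP_cong) (simp_all add: behavior_prod_comp assms)
  also have "\<dots> = behavior (prod_comp R oplus (union_comp E S) B)"
    unfolding behavior_prod_comp interface_union_comp behavior_union_comp by blast
  finally show ?thesis by (rule sym)
qed

lemma union_comp_in_conformance_coordinators:
  assumes "S \<noteq> {}" and "S \<subseteq> conformance_coordinators R oplus A B"
    and "\<And>C. C \<in> S \<Longrightarrow> interface C = E"
  shows "union_comp E S \<in> conformance_coordinators R oplus A B"
proof -
  have coord: "is_component C" "C \<noteq> zero_component" "prod_comp R oplus C B \<sqsubseteq> A" if "C \<in> S" for C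
    using assms(2) that by (auto simp: conformance_coordinators_def)
  \<comment> \<open>This member serves twice: it keeps the union from being zero, and it bounds
    \<open>E\<close> and \<open>interface B\<close> by \<open>interface A\<close>.\<close>
  obtain C where C: "C \<in> S" using assms(1) by blast
  have "is_component (union_comp E S)"
    using coord(1) assms(3) by (rule is_component_union_comp)
  moreover have "union_comp E S \<noteq> zero_component"
    \<comment> \<open>A zero union would force \<open>E = {}\<close> and
      \<open>behavior C = {}\<close>, making \<open>C\<close> itself zero.\<close>
    using coord(2)[OF C] assms(3)[OF C] C by (auto simp: zero_component_iff)
  moreover have "prod_comp R oplus (union_comp E S) B \<sqsubseteq> A"
    unfolding refines_def
  proof
    show "interface (prod_comp R oplus (union_comp E S) B) \<subseteq> interface A"
      using coord(3)[OF C] assms(3)[OF C] by (simp add: refines_def)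
    have "behavior (prod_comp R oplus (union_comp E S) B) =
            (\<Union>C\<in>S. behavior (prod_comp R oplus C B))"
      using assms(3) by (rule behavior_prod_union_comp)
    also have "\<dots> \<subseteq> behavior A"
      using coord(3) by (intro UN_least) (simp add: refines_def)
    finally show "behavior (prod_comp R oplus (union_comp E S) B) \<subseteq> behavior A" .
  qed
  ultimately show ?thesis by (simp add: conformance_coordinators_def)
qed

text \<open>Each stream of \<open>C\<close> also lies in the union and is contained in
  itself.\<close>

lemma comp_contained_union_comp:
  assumes "C \<in> S" and "interface C = E"
  shows "comp_contained C (union_comp E S)"
  using assms by (auto simp: comp_contained_def tes_contained_def)

theorem theorem2:
  fixes R :: "'e composability" and oplus :: "'e composition"
    and A B :: "'e component"
  assumes "interaction_signature R oplus"
    and "commutative_prod R oplus"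
    and "associative_prod R oplus"
    and "idempotent_prod R oplus"
    and "monotonic_prod R oplus"
    and "is_component A" and "is_component B"
    and "conformant R oplus B A"
  shows "\<forall>(E :: 'e set) S. finite S \<longrightarrow> S \<subseteq> conformance_coordinators R oplus A B \<longrightarrow>
           (\<forall>C\<in>S. interface C = E) \<longrightarrow>
           (\<exists>U\<in>conformance_coordinators R oplus A B. \<forall>C\<in>S. comp_contained C U)"
proof (intro allI impI)
  fix E :: "'e set" and S
  assume S: "S \<subseteq> conformance_coordinators R oplus A B" "\<forall>C\<in>S. interface C = E"
  show "\<exists>U\<in>conformance_coordinators R oplus A B. \<forall>C\<in>S. comp_contained C U"
  proof (cases "S = {}")
    case True
    \<comment> \<open>Any coordinator bounds the empty set vacuously, whatever its
      interface.\<close>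
    then show ?thesis
      using assms(8) by (auto simp: conformant_def conformance_coordinators_def)
  next
    case False
    then have "union_comp E S \<in> conformance_coordinators R oplus A B"
      using S by (intro union_comp_in_conformance_coordinators) auto
    moreover have "\<forall>C\<in>S. comp_contained C (union_comp E S)"
      using S(2) by (simp add: comp_contained_union_comp)
    ultimately show ?thesis by (rule rev_bexI)
  qed
qed

end
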